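(* For every fixed $\alpha\in\mathbb{C}$ with $\mathrm{Re}\,\alpha>0$ and every fixed $z\in\mathbb{C}$, the Mittag-Leffler function $E_{\alpha,\beta}(z)$ is differentiable (analytic) as a function of the complex variable $\beta\in\mathbb{C}$, and for all $\beta\in\mathbb{C}$ $$\frac{\partial E_{\alpha,\beta}(z)}{\partial \beta} = - \sum_{k=0}^{\infty} \frac{\psi(\alpha k + \beta)}{\Gamma(\alpha k + \beta)}\, z^k .$$
   Context: The two-parametric Mittag-Leffler function is $E_{\alpha,\beta}(z)=\sum_{k=0}^{\infty}\frac{z^k}{\Gamma(\alpha k+\beta)}$, where $1/\Gamma$ is understood as an entire function (equal to $0$ at $0,-1,-2,\dots$). $\psi=\Gamma'/\Gamma$ is the digamma function. The ratio $\psi(w)/\Gamma(w)$ is understood as an entire function of $w$, namely $\psi(w)/\Gamma(w)=-(1/\Gamma)'(w)$, its removable singularities at $w=0,-1,-2,\dots$ being filled in by continuity. *)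

theory Defs
  imports "HOL-Complex_Analysis.Complex_Analysis"
begin

text \<open>
  The function \<^const>\<open>rGamma\<close> is the entire function $1/\Gamma$, which vanishes
  at the nonpositive integers.
\<close>
definition Mittag_Leffler :: "complex \<Rightarrow> complex \<Rightarrow> complex \<Rightarrow> complex" where
  "Mittag_Leffler \<alpha> \<beta> z = (\<Sum>k. rGamma (\<alpha> * of_nat k + \<beta>) * z ^ k)"

text \<open>
  The quotient $\psi/\Gamma$ as an entire function.  In the library both
  \<^const>\<open>Gamma\<close> and division by zero are totalised by $0$, so the plain quotient
  takes the wrong value $0$ at the nonpositive integers; \<^const>\<open>remove_sings\<close>
  replaces the value at every point by the limit there.  The lemma
  \<open>Digamma_over_Gamma_eq_deriv\<close> below confirms that the result is $-(1/\Gamma)'$.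
\<close>
definition Digamma_over_Gamma :: "complex \<Rightarrow> complex" where
  "Digamma_over_Gamma = remove_sings (\<lambda>w. Digamma w / Gamma w)"

lemma Digamma_over_Gamma_eq_deriv: "Digamma_over_Gamma w = - deriv rGamma w"
proof -
  have "(deriv rGamma) holomorphic_on (UNIV :: complex set)"
    by (intro holomorphic_deriv holomorphic_rGamma) auto
  hence "isCont (deriv rGamma) w"
    by (meson UNIV_I continuous_on_eq_continuous_at holomorphic_on_imp_continuous_on open_UNIV)
  hence lim: "(\<lambda>u. - deriv rGamma u) \<midarrow>w\<rightarrow> - deriv rGamma w"
    by (intro tendsto_minus) (simp add: isCont_def)
  have "eventually (\<lambda>u. u \<notin> \<int>\<^sub>\<le>\<^sub>0) (at w)"
  proof -
    have "closed ((\<int>\<^sub>\<le>\<^sub>0 :: complex set) - {w})"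
      by (rule closed_subset_Ints) (auto elim!: nonpos_Ints_cases)
    hence "eventually (\<lambda>u. u \<in> - ((\<int>\<^sub>\<le>\<^sub>0 :: complex set) - {w})) (nhds w)"
      by (intro eventually_nhds_in_open open_Compl) auto
    thus ?thesis by (auto simp: eventually_at_filter elim!: eventually_mono)
  qed
  hence "eventually (\<lambda>u. - deriv rGamma u = Digamma u / Gamma u) (at w)"
  proof eventually_elim
    case (elim u)
    have "deriv rGamma u = - rGamma u * Digamma u"
      by (rule DERIV_imp_deriv) (rule has_field_derivative_rGamma_no_nonpos_int[OF elim])
    thus ?case by (simp add: rGamma_inverse_Gamma field_simps)
  qed
  with lim have "(\<lambda>u. Digamma u / Gamma u) \<midarrow>w\<rightarrow> - deriv rGamma w"
    by (rule Lim_transform_eventually)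
  thus ?thesis unfolding Digamma_over_Gamma_def by (rule remove_sings_eqI)
qed

lemma Digamma_over_Gamma_eq:
  assumes "w \<notin> \<int>\<^sub>\<le>\<^sub>0"
  shows   "Digamma_over_Gamma w = Digamma w / Gamma w"
proof -
  have "deriv rGamma w = - rGamma w * Digamma w"
    by (rule DERIV_imp_deriv) (rule has_field_derivative_rGamma_no_nonpos_int[OF assms])
  thus ?thesis by (simp add: Digamma_over_Gamma_eq_deriv rGamma_inverse_Gamma field_simps)
qed

end

theory Submission
  imports Defs
begin

text \<open>
  Termwise differentiation is justified by a bound on $1/\Gamma$ in the sector containing the
  points $\alpha k + \beta$, uniform for $\beta$ in a disc. Comparing the factors of Euler's
  product for $1/\Gamma(x+iy)$ with those for $1/\Gamma(x)$ costs at most $e^{y^2/x}$, which in a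
  sector is only exponential in $k$, whereas $1/\Gamma(x)$ decays faster than $A^{-x}$ for
  every $A$. Hence a suitable $A$ gives a geometric majorant for the terms, and locally uniform
  convergence of holomorphic functions allows differentiating under the sum.
\<close>

text \<open>The exponent is a difference of consecutive reciprocals so that it telescopes when these
  factors are multiplied. With x = \<open>Re w + j\<close> and y = \<open>Im w\<close>, the squared
  norm is x^2 (1 + y^2/x^2), and \<open>1 + t \<le> exp t\<close> moves the excess into an
  exponential.\<close>

lemma norm_add_of_nat_le:
  fixes w :: complex
  assumes "Re w \<ge> 1"
  shows "norm (w + of_nat j) \<le> (Re w + j) *
           exp ((Im w)\<^sup>2 * (1 / (Re w + j) - 1 / (Re w + Suc j)))"
proof -
  define x y where "x = Re w + j" and "y = Im w"
  have x: "x \<ge> 1" using assms by (simp add: x_def)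
  \<comment> \<open>Equivalent to x + 1 \<le> 2x, hence the requirement x \<ge> 1. The factor 2 is
    cancelled by the square root taken at the end.\<close>
  have "1 / x\<^sup>2 \<le> 2 / (x * (x + 1))"
    using x by (simp add: divide_simps power2_eq_square)
  also have "\<dots> = 2 * (1 / x - 1 / (x + 1))"
    using x by (simp add: field_simps)
  finally have "y\<^sup>2 * (1 / x\<^sup>2) \<le> y\<^sup>2 * (2 * (1 / x - 1 / (x + 1)))"
    by (rule mult_left_mono) auto
  hence "y\<^sup>2 / x\<^sup>2 \<le> 2 * (y\<^sup>2 * (1 / x - 1 / (x + 1)))"
    by (simp only: times_divide_eq_right mult_1_right mult.left_commute)
  hence le: "1 + y\<^sup>2 / x\<^sup>2 \<le> exp (2 * (y\<^sup>2 * (1 / x - 1 / (x + 1))))"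
    by (intro order.trans[OF add_left_mono exp_ge_add_one_self])
  have "(norm (w + of_nat j))\<^sup>2 = x\<^sup>2 * (1 + y\<^sup>2 / x\<^sup>2)"
    using x by (simp add: cmod_power2 x_def y_def field_simps)
  also have "\<dots> \<le> x\<^sup>2 * exp (2 * (y\<^sup>2 * (1 / x - 1 / (x + 1))))"
    by (intro mult_left_mono le) auto
  also have "\<dots> = (x * exp (y\<^sup>2 * (1 / x - 1 / (x + 1))))\<^sup>2"
    unfolding power_mult_distrib exp_double ..
  finally have "norm (w + of_nat j) \<le> x * exp (y\<^sup>2 * (1 / x - 1 / (x + 1)))"
    by (rule power2_le_imp_le) (use x in auto)
  thus ?thesis by (simp add: x_def y_def add_ac)
qed

lemma norm_pochhammer_le:
  fixes w :: complex
  assumes "Re w \<ge> 1"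
  shows "norm (pochhammer w n) \<le> pochhammer (Re w) n *
           exp ((Im w)\<^sup>2 * (1 / Re w - 1 / (Re w + n)))"
proof (induction n)
  case 0
  thus ?case by simp
next
  case (Suc n)
  let ?e = "\<lambda>a b. exp ((Im w)\<^sup>2 * (1 / (a::real) - 1 / b))"
  have "norm (pochhammer w (Suc n)) = norm (pochhammer w n) * norm (w + of_nat n)"
    by (simp add: pochhammer_Suc norm_mult)
  also have "\<dots> \<le> (pochhammer (Re w) n * ?e (Re w) (Re w + n)) *
                    ((Re w + n) * ?e (Re w + n) (Re w + Suc n))"
    by (intro mult_mono Suc.IH norm_add_of_nat_le assms mult_nonneg_nonneg pochhammer_nonneg)
       (use assms in auto)
  also have "\<dots> = pochhammer (Re w) (Suc n) *
                    (?e (Re w) (Re w + n) * ?e (Re w + n) (Re w + Suc n))"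
    by (simp add: pochhammer_Suc)
  also have "?e (Re w) (Re w + n) * ?e (Re w + n) (Re w + Suc n) = ?e (Re w) (Re w + Suc n)"
    by (simp add: exp_add [symmetric] algebra_simps)
  finally show ?case .
qed

text \<open>Euler's product passes to the limit. In its n-th approximation the power of n has
  modulus depending only on \<open>Re w\<close>, and dropping the negative part of the telescoped
  exponent gives a factor independent of n.\<close>

lemma norm_rGamma_le_real:
  fixes w :: complex
  assumes "Re w \<ge> 1"
  shows "norm (rGamma w) \<le> rGamma (Re w) * exp ((Im w)\<^sup>2 / Re w)"
proof (rule LIMSEQ_le)
  show "(\<lambda>n. norm (rGamma_series w n)) \<longlonglongrightarrow> norm (rGamma w)"
    by (intro tendsto_intros)
  show "(\<lambda>n. rGamma_series (Re w) n * exp ((Im w)\<^sup>2 / Re w))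
           \<longlonglongrightarrow> rGamma (Re w) * exp ((Im w)\<^sup>2 / Re w)"
    by (intro tendsto_intros)
  have "norm (rGamma_series w n) \<le> rGamma_series (Re w) n * exp ((Im w)\<^sup>2 / Re w)" for n
  proof -
    let ?d = "fact n * exp (Re w * ln (real n))"
    have "norm (rGamma_series w n) = norm (pochhammer w (n + 1)) / ?d"
      by (simp add: rGamma_series_def norm_divide norm_mult)
    also have "\<dots> \<le> pochhammer (Re w) (n + 1) *
                      exp ((Im w)\<^sup>2 * (1 / Re w - 1 / (Re w + (n + 1)))) / ?d"
      by (intro divide_right_mono order.trans[OF norm_pochhammer_le] assms) auto
    also have "\<dots> \<le> pochhammer (Re w) (n + 1) * exp ((Im w)\<^sup>2 * (1 / Re w)) / ?d"
      using assms
      by (intro divide_right_mono mult_left_mono iffD2[OF exp_le_cancel_iff] pochhammer_nonneg) auto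
    also have "\<dots> = rGamma_series (Re w) n * exp ((Im w)\<^sup>2 / Re w)"
      by (simp add: rGamma_series_def)
    finally show ?thesis .
  qed
  thus "\<exists>N. \<forall>n\<ge>N. norm (rGamma_series w n) \<le> rGamma_series (Re w) n * exp ((Im w)\<^sup>2 / Re w)"
    by blast
qed

lemma power_div_fact_le_exp:
  fixes A :: real
  assumes "A \<ge> 0"
  shows "A ^ n / fact n \<le> exp A"
proof -
  have "(\<Sum>k\<in>{n}. A ^ k /\<^sub>R fact k) \<le> (\<Sum>k. A ^ k /\<^sub>R fact k)"
    by (intro sum_le_suminf summable_exp_generic) (use assms in auto)
  thus ?thesis by (simp add: exp_def divide_inverse mult_ac)
qed

text \<open>Factorial growth beats any power: a single term of the exponential series gives A^n
  \<le> e^A n!, and n! is compared with \<open>Gamma x\<close> for a nearby integer n.\<close>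

lemma rGamma_real_le:
  fixes x A :: real
  assumes "x \<ge> 2" "A \<ge> 1"
  shows "rGamma x \<le> exp A * A powr (2 - x)"
proof -
  \<comment> \<open>The shift by one makes n + 1 the integer part of x, so n! = Gamma(n + 1) \<le>
    \<open>Gamma x\<close>. Since x \<ge> 2, the subtraction does not truncate, and n + 1 \<ge> 2
    lies where Gamma increases.\<close>
  define n where "n = nat \<lfloor>x\<rfloor> - 1"
  have n: "real n + 1 \<le> x" "x < real n + 2"
    using assms unfolding n_def by linarith+
  have "n \<ge> 1" using assms unfolding n_def by linarith
  have "A powr (x - 2) \<le> A powr real n"
    using n assms by (intro powr_mono) auto
  also have "\<dots> = A ^ n"
    using assms by (simp add: powr_realpow)
  also have "\<dots> \<le> exp A * fact n"
    using power_div_fact_le_exp[of A n] assms by (simp add: field_simps)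
  also have "fact n \<le> Gamma x"
  proof (cases "x = real n + 1")
    case True
    thus ?thesis using Gamma_fact[of n, where 'a = real] by (simp add: add_ac)
  next
    case False
    with n \<open>n \<ge> 1\<close> have "Gamma (real n + 1) < Gamma x"
      by (intro Gamma_real_strict_mono) auto
    thus ?thesis using Gamma_fact[of n, where 'a = real] by (simp add: add_ac)
  qed
  finally have "A powr (x - 2) \<le> exp A * Gamma x"
    by simp
  moreover have "A powr (2 - x) = 1 / A powr (x - 2)"
    using powr_minus_divide[of A "x - 2"] by simp
  ultimately have "1 \<le> Gamma x * (exp A * A powr (2 - x))"
    using assms by (simp add: pos_divide_le_eq mult_ac)
  thus ?thesis
    using assms by (simp add: rGamma_inverse_Gamma inverse_eq_divide pos_divide_le_eq mult_ac)
qed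

text \<open>One geometric majorant serves all \<beta> in the disc: shifting by \<beta> changes
  \<open>Re w\<close> by at most \<open>\<bar>r\<bar>\<close>, which affects only the
  constant.\<close>

lemma Mittag_Leffler_terms_bound:
  fixes \<alpha> z :: complex
  assumes "Re \<alpha> > 0"
  obtains C where "\<forall>\<^sub>F k in sequentially. \<forall>\<beta>. norm \<beta> \<le> r \<longrightarrow>
                     norm (rGamma (\<alpha> * of_nat k + \<beta>) * z ^ k) \<le> C * (1/2) ^ k"
proof
  define a where "a = Re \<alpha>"
  \<comment> \<open>D bounds the cost of the imaginary part:
    \<open>(Im w)\<^sup>2 / Re w \<le> k * D\<close>. A is then chosen so that the decay
    \<open>A powr (- a)\<close> per step beats \<open>exp D * norm z\<close> by a factor of at least
    2; adding 1 to \<open>norm z\<close> keeps A \<ge> 1 even for z = 0.\<close>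
  define D where "D = 2 * (norm \<alpha> + \<bar>r\<bar>)\<^sup>2 / a"
  define A where "A = (2 * exp D * (norm z + 1)) powr (1 / a)"
  have a: "a > 0" using assms by (simp add: a_def)
  have D: "D \<ge> 0" using a by (simp add: D_def)
  have base: "2 * exp D * (norm z + 1) \<ge> 1"
  proof -
    have "1 * 1 \<le> (2 * exp D) * (norm z + 1)"
      by (intro mult_mono) (use D one_le_exp_iff[of D] in \<open>auto simp del: one_le_exp_iff\<close>)
    thus ?thesis by simp
  qed
  hence A: "A \<ge> 1" unfolding A_def using a by (intro ge_one_powr_ge_zero) auto
  have A_powr: "A powr a = 2 * exp D * (norm z + 1)"
    using a base by (simp add: A_def powr_powr)
  have ratio: "exp D * norm z * A powr (- a) \<le> 1 / 2"
  proof -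
    have "exp D * norm z * A powr (- a) = norm z / (2 * (norm z + 1))"
      unfolding powr_minus A_powr by (simp add: inverse_eq_divide)
    also have "\<dots> \<le> 1 / 2"
      by (subst pos_divide_le_eq) (auto simp: add_nonneg_pos)
    finally show ?thesis .
  qed
  \<comment> \<open>Past this threshold, \<open>a * k - \<bar>r\<bar>\<close> is at least both
    \<open>a * k / 2\<close> and 2; k \<ge> 1 lets \<open>\<bar>r\<bar>\<close> be absorbed into
    \<open>\<bar>r\<bar> * k\<close>.\<close>
  have "\<forall>\<^sub>F k in sequentially. k \<ge> max 1 (nat \<lceil>2 * (\<bar>r\<bar> + 2) / a\<rceil>)"
    by (rule eventually_ge_at_top)
  thus "\<forall>\<^sub>F k in sequentially. \<forall>\<beta>. norm \<beta> \<le> r \<longrightarrow>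
          norm (rGamma (\<alpha> * of_nat k + \<beta>) * z ^ k) \<le> (exp A * A powr (2 + \<bar>r\<bar>)) * (1/2) ^ k"
  proof eventually_elim
    case (elim k)
    hence k: "real k \<ge> 1" and "real k \<ge> 2 * (\<bar>r\<bar> + 2) / a"
      by linarith+
    hence "a * k \<ge> 2 * (\<bar>r\<bar> + 2)"
      using a by (simp add: field_simps)
    hence ak: "a * k \<ge> 2 * \<bar>r\<bar> + 4" by simp
    show ?case
    proof (intro allI impI)
      fix \<beta> :: complex
      assume \<beta>: "norm \<beta> \<le> r"
      define w where "w = \<alpha> * of_nat k + \<beta>"
      have "Re w = a * k + Re \<beta>" by (simp add: w_def a_def)
      hence re: "Re w \<ge> a * k - \<bar>r\<bar>" using \<beta> abs_Re_le_cmod[of \<beta>] by linarith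
      hence re2: "Re w \<ge> a * k / 2" "Re w \<ge> 2" using ak by linarith+
      have "\<bar>Im w\<bar> \<le> norm w" by (rule abs_Im_le_cmod)
      also have "norm w \<le> norm \<alpha> * k + norm \<beta>"
        unfolding w_def by (rule norm_triangle_le) (simp add: norm_mult)
      also have "\<dots> \<le> norm \<alpha> * k + \<bar>r\<bar> * k"
        using \<beta> k mult_left_mono[of 1 "real k" "\<bar>r\<bar>"] by simp
      finally have "\<bar>Im w\<bar> \<le> (norm \<alpha> + \<bar>r\<bar>) * k" by (simp add: algebra_simps)
      hence "(Im w)\<^sup>2 \<le> ((norm \<alpha> + \<bar>r\<bar>) * k)\<^sup>2"
        by (metis abs_ge_zero power2_abs power_mono)
      hence "(Im w)\<^sup>2 / Re w \<le> ((norm \<alpha> + \<bar>r\<bar>) * k)\<^sup>2 / (a * k / 2)"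
        using re2 a k by (intro frac_le) auto
      also have "\<dots> = k * D"
        using a k by (simp add: D_def field_simps power2_eq_square)
      finally have im: "exp ((Im w)\<^sup>2 / Re w) \<le> exp D ^ k"
        by (simp flip: exp_of_nat_mult)
      have "rGamma (Re w) \<le> exp A * A powr (2 - Re w)"
        by (rule rGamma_real_le) (use re2 A in auto)
      also have "\<dots> \<le> exp A * A powr ((2 + \<bar>r\<bar>) + k * (- a))"
        using re A by (intro mult_left_mono powr_mono) (auto simp: mult_ac)
      also have "\<dots> = exp A * A powr (2 + \<bar>r\<bar>) * (A powr (- a)) ^ k"
        using A by (subst powr_power) (auto simp only: powr_add mult.assoc)
      finally have rG: "rGamma (Re w) \<le> \<dots>" .
      have "norm (rGamma w * z ^ k) = norm (rGamma w) * norm z ^ k"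
        by (simp add: norm_mult norm_power)
      also have "\<dots> \<le> (exp A * A powr (2 + \<bar>r\<bar>) * (A powr (- a)) ^ k * exp D ^ k) * norm z ^ k"
        by (intro mult_right_mono order.trans[OF norm_rGamma_le_real] mult_mono rG im)
           (use re2 in auto)
      also have "\<dots> = exp A * A powr (2 + \<bar>r\<bar>) * (exp D * norm z * A powr (- a)) ^ k"
        by (simp add: power_mult_distrib mult_ac)
      also have "\<dots> \<le> exp A * A powr (2 + \<bar>r\<bar>) * (1 / 2) ^ k"
        by (intro mult_left_mono power_mono ratio) auto
      finally show "norm (rGamma (\<alpha> * of_nat k + \<beta>) * z ^ k) \<le>
                      exp A * A powr (2 + \<bar>r\<bar>) * (1 / 2) ^ k"
        by (simp add: w_def)
    qed
  qed
qed

text \<open>Valid at the poles of Gamma too, which the points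
  \<open>\<alpha> * of_nat k + \<beta>\<close> may hit.\<close>

lemma has_field_derivative_rGamma_Digamma_over_Gamma:
  "(rGamma has_field_derivative - Digamma_over_Gamma w) (at w)"
proof -
  have "rGamma field_differentiable at w"
    using holomorphic_rGamma[of UNIV] by (simp add: holomorphic_on_def)
  thus ?thesis
    by (simp add: Digamma_over_Gamma_eq_deriv DERIV_deriv_iff_field_differentiable)
qed

theorem proposition2p2:
  fixes \<alpha> z :: complex
  assumes "Re \<alpha> > 0"
  shows "(\<lambda>\<beta>. Mittag_Leffler \<alpha> \<beta> z) analytic_on UNIV \<and>
    (\<forall>\<beta>. summable (\<lambda>k. Digamma_over_Gamma (\<alpha> * of_nat k + \<beta>) * z ^ k) \<and>
      ((\<lambda>b. Mittag_Leffler \<alpha> b z) has_field_derivative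
        - (\<Sum>k. Digamma_over_Gamma (\<alpha> * of_nat k + \<beta>) * z ^ k)) (at \<beta>))"
proof -
  let ?f = "\<lambda>k \<beta>. rGamma (\<alpha> * of_nat k + \<beta>) * z ^ k"
  let ?f' = "\<lambda>k \<beta>. - (Digamma_over_Gamma (\<alpha> * of_nat k + \<beta>) * z ^ k)"
  have deriv: "(?f k has_field_derivative ?f' k \<beta>) (at \<beta>)" for k \<beta>
    by (rule derivative_eq_intros DERIV_chain2[OF has_field_derivative_rGamma_Digamma_over_Gamma]
          refl | simp)+
  have bound: "\<exists>d h. 0 < d \<and> summable h \<and>
      (\<forall>\<^sub>F k in sequentially. \<forall>b\<in>ball \<beta> d \<inter> UNIV. norm (?f k b) \<le> h k)" for \<beta>
  proof -
    obtain C where C: "\<forall>\<^sub>F k in sequentially. \<forall>b. norm b \<le> norm \<beta> + 1 \<longrightarrow>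
        norm (?f k b) \<le> C * (1/2) ^ k"
      using Mittag_Leffler_terms_bound[OF assms] .
    have "norm b \<le> norm \<beta> + 1" if "b \<in> ball \<beta> 1" for b
      using that norm_triangle_ineq2[of b \<beta>] by (simp add: dist_norm norm_minus_commute)
    hence "\<forall>\<^sub>F k in sequentially. \<forall>b\<in>ball \<beta> 1 \<inter> UNIV. norm (?f k b) \<le> C * (1/2) ^ k"
      using C by (auto elim!: eventually_mono)
    moreover have "summable (\<lambda>k. C * (1/2 :: real) ^ k)"
      by (intro summable_mult summable_geometric) auto
    ultimately show ?thesis
      by (intro exI[of _ 1] exI[of _ "\<lambda>k. C * (1/2) ^ k"]) auto
  qed
  \<comment> \<open>Weierstrass' theorem: a local majorant for the holomorphic terms alone also
    yields convergence of the series of derivatives, so \<open>Digamma_over_Gamma\<close> is never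
    estimated.\<close>
  obtain g g' where g: "\<And>\<beta>. (\<lambda>k. ?f k \<beta>) sums g \<beta>"
    and g': "\<And>\<beta>. (\<lambda>k. ?f' k \<beta>) sums g' \<beta>"
    and gd: "\<And>\<beta>. (g has_field_derivative g' \<beta>) (at \<beta>)"
    using series_and_derivative_comparison_local[of UNIV ?f ?f', OF open_UNIV deriv bound]
    by auto
  have g_eq: "g = (\<lambda>\<beta>. Mittag_Leffler \<alpha> \<beta> z)"
    using g by (auto simp: Mittag_Leffler_def sums_iff)
  have sums: "(\<lambda>k. Digamma_over_Gamma (\<alpha> * of_nat k + \<beta>) * z ^ k) sums (- g' \<beta>)" for \<beta>
    using sums_minus[OF g'[of \<beta>]] by simp
  \<comment> \<open>Complex differentiability at every point of an open set is analyticity.\<close>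
  have "(\<lambda>\<beta>. Mittag_Leffler \<alpha> \<beta> z) analytic_on UNIV"
    using gd unfolding g_eq by (auto simp: analytic_on_open holomorphic_on_open)
  with gd sums show ?thesis
    unfolding g_eq by (auto simp: sums_iff)
qed

end
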